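(* Let $b,k,m$ be positive integers with $m\ge 5$. Then, modulo $5^{m+5}$, $$S_{k\varphi(5^m)+b}-(1+5^b)S_b\equiv\begin{cases} 5^{m-1}k(930-4875b-4625b^2-6250b^3-3125b^4)&\text{if } b\equiv 0\pmod 4,\\ 5^{m-1}k(4670+1450b+1250b^2+6250b^3+3125b^4+6250b^5)&\text{if } b\equiv 1\pmod 4,\\ 5^{m-1}k(-4235+3700b-3000b^2+6250b^3-9375b^4+6250b^5)&\text{if } b\equiv 2\pmod 4,\\ 5^{m-1}k(3725-1025b-2625b^2+6250b^3+3125b^5)&\text{if } b\equiv 3\pmod 4.\end{cases}$$
   Context: The integer sequence $\{S_n\}_{n\ge0}$ is defined by $S_0=1$ and $S_n=1-\sum_{j=0}^{n-1}\binom{n}{j}2^{2n-2j-1}S_j$ for $n\ge 1$. $\varphi$ denotes Euler's totient function. *)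

theory Defs
  imports "HOL-Number_Theory.Number_Theory"
begin

text \<open>
  The recurrence is stated at index \<open>Suc n\<close> in place of a positive index.  As \<open>j < Suc n\<close>, the
  truncated subtraction in the exponent agrees with integer subtraction.
\<close>

fun S :: "nat \<Rightarrow> int" where
  "S 0 = 1"
| "S (Suc n) = 1 - (\<Sum>j<Suc n. int (Suc n choose j) * 2 ^ (2 * Suc n - 2 * j - 1) * S j)"

end

theory Submission
  imports Defs
begin

text \<open>
  The exponential generating function of \<open>S\<close> is \<open>2 * exp x / (1 + exp (4 * x))\<close>, so \<open>S n\<close> is
  the limit, in the 5-adic sense, of the alternating sums of \<open>(4 * i + 1) ^ n\<close> over \<open>i < 5 ^ M\<close>.  The factor
  \<open>1 + 5 ^ n\<close> removes the multiples of 5 from these sums, and \<open>u ^ 4\<close> is 1 modulo 5 for every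
  remaining base \<open>u\<close>.  Hence the \<open>s\<close>-th difference of \<open>t \<mapsto> (1 + 5 ^ n) * S n\<close>, with
  \<open>n = r + 4 * t\<close>, is divisible by \<open>5 ^ s\<close>, and Newton's formula shows that a shift of \<open>t\<close> by
  \<open>N = k * 5 ^ (m - 1)\<close> changes this function by \<open>N\<close> times the truncated logarithm of the shift
  operator.  The logarithm is in turn a polynomial in \<open>t\<close> of degree 4 modulo \<open>5 ^ 6\<close>, determined
  by finitely many values of \<open>S\<close>; the claimed polynomials agree with it up to multiples of
  \<open>5 ^ 5 * (t ^ 5 - t)\<close>.
\<close>

section \<open>The recurrence as a binomial transform, and alternating power sums\<close>

text \<open>Doubling the recurrence turns \<open>2 ^ (2 * n - 2 * j - 1)\<close> into
  \<open>4 ^ (n - j)\<close>, and one of the two copies of \<open>S n\<close> becomes the summand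
  \<open>j = n\<close>. In terms of the generating function \<open>F\<close> this is
  \<open>(exp (4 * x) + 1) * F = 2 * exp x\<close>.\<close>

lemma S_binomial_transform:
  "(\<Sum>j\<le>n. int (n choose j) * 4 ^ (n - j) * S j) + S n = 2"
proof (cases n)
  case (Suc p)
  have "2 * (int (Suc p choose j) * 2 ^ (2 * Suc p - 2 * j - 1) * S j)
      = int (Suc p choose j) * 4 ^ (Suc p - j) * S j" if "j < Suc p" for j
  proof -
    from that have "2 * Suc p - 2 * j = Suc (2 * Suc p - 2 * j - 1)" by simp
    then have "2 * 2 ^ (2 * Suc p - 2 * j - 1) = (2 ^ (2 * (Suc p - j)) :: int)"
      by (metis power_Suc diff_mult_distrib2)
    also have "\<dots> = 4 ^ (Suc p - j)"
      by (subst power_mult) simp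
    finally have "2 * 2 ^ (2 * Suc p - 2 * j - 1) = (4 ^ (Suc p - j) :: int)" .
    moreover have "2 * (a * c * d) = a * (2 * c) * d" for a c d :: int
      by simp
    ultimately show ?thesis
      by (simp only:)
  qed
  then have "2 * (\<Sum>j<Suc p. int (Suc p choose j) * 2 ^ (2 * Suc p - 2 * j - 1) * S j)
      = (\<Sum>j<Suc p. int (Suc p choose j) * 4 ^ (Suc p - j) * S j)"
    unfolding sum_distrib_left by (intro sum.cong) (simp_all del: S.simps)
  moreover have "{..Suc p} = insert (Suc p) {..<Suc p}" by auto
  then have "(\<Sum>j\<le>Suc p. f j) = f (Suc p) + (\<Sum>j<Suc p. f j)" for f :: "nat \<Rightarrow> int"
    by simp
  ultimately show ?thesis
    using S.simps(2) [of p] Suc by (simp del: S.simps(2) sum.lessThan_Suc sum.atMost_Suc)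
qed simp

text \<open>The value \<open>x n\<close> enters its equation with coefficient 2, a unit modulo an
  odd \<open>M\<close>, so the earlier values determine it. The bound \<open>K\<close> admits
  sequences given by a finite table.\<close>

lemma cong_S_if_binomial_transform:
  fixes x :: "nat \<Rightarrow> int" and M :: int
  assumes "odd M"
    and transform: "\<And>n. n < K \<Longrightarrow>
      [(\<Sum>j\<le>n. int (n choose j) * 4 ^ (n - j) * x j) + x n = 2] (mod M)"
    and "n < K"
  shows "[x n = S n] (mod M)"
  using \<open>n < K\<close>
proof (induction n rule: less_induct)
  case (less n)
  have split: "(\<Sum>j\<le>n. int (n choose j) * 4 ^ (n - j) * y j) + y n
      = (\<Sum>j<n. int (n choose j) * 4 ^ (n - j) * y j) + 2 * y n" for y :: "nat \<Rightarrow> int"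
    by (simp add: lessThan_Suc_atMost [symmetric])
  have total: "[(\<Sum>j<n. int (n choose j) * 4 ^ (n - j) * x j) + 2 * x n
      = (\<Sum>j<n. int (n choose j) * 4 ^ (n - j) * S j) + 2 * S n] (mod M)"
    using transform [OF less.prems] S_binomial_transform [of n] by (simp add: split)
  have "[(\<Sum>j<n. int (n choose j) * 4 ^ (n - j) * x j)
      = (\<Sum>j<n. int (n choose j) * 4 ^ (n - j) * S j)] (mod M)"
    using less by (intro cong_sum cong_mult) auto
  from cong_diff [OF total this] have "[2 * x n = 2 * S n] (mod M)"
    by simp
  moreover have "coprime 2 M"
    using \<open>odd M\<close> by simp
  ultimately show ?case
    by (simp add: cong_mult_lcancel)
qed

text \<open>By the binomial theorem the transform turns \<open>(4 * i + 1) ^ n\<close> into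
  \<open>(4 * (i + 1) + 1) ^ n\<close>, which is the next summand up to sign. Adding the original
  sum therefore telescopes, to \<open>1 + (4 * N + 1) ^ n\<close> for odd \<open>N\<close>.\<close>

lemma alternating_power_sum_cong_S:
  assumes "odd N"
  shows "[(\<Sum>i<N. (-1) ^ i * (4 * int i + 1) ^ n) = S n] (mod int N)"
proof (rule cong_S_if_binomial_transform [where K = "Suc n"])
  fix n :: nat
  let ?g = "\<lambda>i. (-1) ^ i * (4 * int i + 1) ^ n"
  have binom: "(\<Sum>j\<le>n. int (n choose j) * 4 ^ (n - j) * ((-1) ^ i * (4 * int i + 1) ^ j))
      = - ?g (Suc i)" for i
  proof -
    have "(\<Sum>j\<le>n. int (n choose j) * 4 ^ (n - j) * ((-1) ^ i * (4 * int i + 1) ^ j))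
        = (-1) ^ i * (\<Sum>j\<le>n. int (n choose j) * (4 * int i + 1) ^ j * 4 ^ (n - j))"
      by (simp only: sum_distrib_left ac_simps)
    also have "\<dots> = (-1) ^ i * (4 * int i + 1 + 4) ^ n"
      by (simp only: binomial_ring of_nat_id)
    also have "4 * int i + 1 + 4 = 4 * int (Suc i) + 1"
      by simp
    finally show ?thesis
      by simp
  qed
  have "(\<Sum>j\<le>n. int (n choose j) * 4 ^ (n - j) * (\<Sum>i<N. (-1) ^ i * (4 * int i + 1) ^ j))
      = (\<Sum>i<N. \<Sum>j\<le>n. int (n choose j) * 4 ^ (n - j) * ((-1) ^ i * (4 * int i + 1) ^ j))"
    unfolding sum_distrib_left by (rule sum.swap)
  also have "\<dots> = (\<Sum>i<N. - ?g (Suc i))"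
    by (simp only: binom)
  finally have "(\<Sum>j\<le>n. int (n choose j) * 4 ^ (n - j) * (\<Sum>i<N. (-1) ^ i * (4 * int i + 1) ^ j))
      + (\<Sum>i<N. ?g i) = (\<Sum>i<N. ?g i - ?g (Suc i))"
    by (simp only: sum_negf sum_subtractf)
  also have "\<dots> = 1 + (4 * int N + 1) ^ n"
    using \<open>odd N\<close> by (subst sum_lessThan_telescope') simp
  finally show "[(\<Sum>j\<le>n. int (n choose j) * 4 ^ (n - j) * (\<Sum>i<N. (-1) ^ i * (4 * int i + 1) ^ j))
      + (\<Sum>i<N. ?g i) = 2] (mod int N)"
  proof (simp only:)
    have "[1 + (4 * int N + 1) ^ n = 1 + (0 + 1) ^ n] (mod int N)"
      by (intro cong_pow cong_add cong_refl) (simp add: cong_0_iff)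
    then show "[1 + (4 * int N + 1) ^ n = 2] (mod int N)"
      by simp
  qed
qed (use \<open>odd N\<close> in auto)

section \<open>Restriction to bases prime to 5\<close>

definition unit_S :: "nat \<Rightarrow> int" where
  "unit_S n = (1 + 5 ^ n) * S n"

text \<open>
  The terms of the alternating power sum with \<open>5 dvd 4 * i + 1\<close> are those with \<open>i = 5 * j + 1\<close>;
  they form \<open>- 5 ^ n\<close> times a shorter alternating power sum.
\<close>

lemma unit_S_cong_unit_power_sum:
  "[unit_S n = (\<Sum>i | i < 5 ^ Suc M \<and> i mod 5 \<noteq> 1. (-1) ^ i * (4 * int i + 1) ^ n)] (mod 5 ^ M)"
proof -
  let ?g = "\<lambda>i. (-1) ^ i * (4 * int i + 1) ^ n"
  have "bij_betw (\<lambda>j. 5 * j + 1) {..<5 ^ M} {i. i < 5 ^ Suc M \<and> i mod 5 = (1 :: nat)}"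
  proof (rule bij_betw_byWitness [where f' = "\<lambda>i. i div 5"])
    have "5 * (i div 5) + 1 = i" if "i mod 5 = 1" for i :: nat
      using mult_div_mod_eq [of 5 i] that by simp
    then show "\<forall>i\<in>{i. i < 5 ^ Suc M \<and> i mod 5 = 1}. 5 * (i div 5) + 1 = (i :: nat)"
      by blast
    have "5 * j + 1 < 5 ^ Suc M \<and> (5 * j + 1) mod 5 = 1" if "j < 5 ^ M" for j :: nat
      using that by (auto simp: mod_Suc)
    then show "(\<lambda>j. 5 * j + 1) ` {..<5 ^ M :: nat} \<subseteq> {i. i < 5 ^ Suc M \<and> i mod 5 = 1}"
      by blast
  qed (auto simp: less_mult_imp_div_less)
  then have "(\<Sum>i | i < 5 ^ Suc M \<and> i mod 5 = 1. ?g i) = (\<Sum>j<5 ^ M. ?g (5 * j + 1))"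
    by (rule sum.reindex_bij_betw [symmetric])
  also have "\<dots> = (\<Sum>j<5 ^ M. - (5 ^ n * ?g j))"
  proof (rule sum.cong)
    fix j :: nat
    have "4 * int (5 * j + 1) + 1 = 5 * (4 * int j + 1)" by simp
    moreover have "(-1) ^ (5 * j + 1) = - ((-1) ^ j :: int)"
      by (simp add: minus_one_power_iff)
    ultimately show "?g (5 * j + 1) = - (5 ^ n * ?g j)"
      by (simp only: power_mult_distrib mult_minus_left mult.left_commute)
  qed simp
  also have "\<dots> = - (5 ^ n * (\<Sum>j<5 ^ M. ?g j))"
    by (simp add: sum_negf sum_distrib_left)
  finally have multiples: "(\<Sum>i | i < 5 ^ Suc M \<and> i mod 5 = 1. ?g i)
      = - (5 ^ n * (\<Sum>j<5 ^ M. ?g j))" .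
  have "{..<5 ^ Suc M} = {i. i < 5 ^ Suc M \<and> i mod 5 = 1} \<union> {i. i < 5 ^ Suc M \<and> i mod 5 \<noteq> (1 :: nat)}"
    by blast
  then have "(\<Sum>i<5 ^ Suc M. ?g i)
      = (\<Sum>i | i < 5 ^ Suc M \<and> i mod 5 = 1. ?g i) + (\<Sum>i | i < 5 ^ Suc M \<and> i mod 5 \<noteq> 1. ?g i)"
    by (simp only:) (rule sum.union_disjoint; force)
  then have units: "(\<Sum>i | i < 5 ^ Suc M \<and> i mod 5 \<noteq> 1. ?g i)
      = (\<Sum>i<5 ^ Suc M. ?g i) + 5 ^ n * (\<Sum>j<5 ^ M. ?g j)"
    using multiples by linarith
  have "[(\<Sum>i<5 ^ Suc M. ?g i) = S n] (mod 5 ^ M)"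
    by (rule cong_dvd_modulus [OF alternating_power_sum_cong_S]) simp_all
  moreover have "[(\<Sum>i<5 ^ M. ?g i) = S n] (mod 5 ^ M)"
    using alternating_power_sum_cong_S [of "5 ^ M" n] by auto
  ultimately have "[(\<Sum>i<5 ^ Suc M. ?g i) + 5 ^ n * (\<Sum>j<5 ^ M. ?g j) = unit_S n] (mod 5 ^ M)"
    unfolding unit_S_def distrib_right mult_1 by (intro cong_add cong_mult cong_refl)
  then show ?thesis
    unfolding units by (rule cong_sym)
qed

section \<open>Forward differences and Newton's formula\<close>

definition fwd_diff :: "(nat \<Rightarrow> int) \<Rightarrow> nat \<Rightarrow> int" where
  "fwd_diff f t = f (Suc t) - f t"

lemma fwd_diff_cong:
  assumes "\<And>t. [f t = g t] (mod M)"
  shows "[(fwd_diff ^^ s) f t = (fwd_diff ^^ s) g t] (mod M)"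
proof (induction s arbitrary: t)
  case (Suc s)
  show ?case
    using cong_diff [OF Suc.IH [of "Suc t"] Suc.IH [of t]] by (simp add: fwd_diff_def)
qed (simp add: assms)

text \<open>Each function \<open>x i ^ t\<close> of \<open>t\<close> is an eigenvector of
  \<open>fwd_diff\<close> with eigenvalue \<open>x i - 1\<close>.\<close>

lemma fwd_diff_exponential_sum:
  "(fwd_diff ^^ s) (\<lambda>t. \<Sum>i\<in>I. c i * x i ^ t) t = (\<Sum>i\<in>I. c i * x i ^ t * (x i - 1) ^ s)"
proof (induction s arbitrary: t)
  case (Suc s)
  then show ?case
    by (simp add: fwd_diff_def sum_subtractf [symmetric] algebra_simps)
qed simp

text \<open>The shift by \<open>n\<close> is \<open>(1 + fwd_diff) ^ n\<close>. The induction
  generalises \<open>f\<close> because its hypothesis is applied to both \<open>f\<close> and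
  \<open>fwd_diff f\<close>.\<close>

lemma newton_forward:
  "f (t + n) = (\<Sum>s\<le>n. int (n choose s) * (fwd_diff ^^ s) f t)"
proof (induction n arbitrary: f)
  case (Suc n)
  have "f (t + Suc n) = f (t + n) + fwd_diff f (t + n)"
    by (simp add: fwd_diff_def)
  also have "\<dots> = (\<Sum>s\<le>n. int (n choose s) * (fwd_diff ^^ s) f t)
      + (\<Sum>s\<le>n. int (n choose s) * (fwd_diff ^^ Suc s) f t)"
    by (simp add: Suc.IH [of f] Suc.IH [of "fwd_diff f"] funpow_swap1)
  also have "(\<Sum>s\<le>n. int (n choose s) * (fwd_diff ^^ s) f t)
      = (\<Sum>s\<le>Suc n. int (n choose s) * (fwd_diff ^^ s) f t)"
    by simp
  also have "\<dots> = f t + (\<Sum>s\<le>n. int (n choose Suc s) * (fwd_diff ^^ Suc s) f t)"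
    by (subst sum.atMost_Suc_shift) simp
  finally show ?case
    by (subst sum.atMost_Suc_shift) (simp add: sum.distrib [symmetric] algebra_simps)
qed simp

text \<open>Modulo \<open>5 ^ s\<close> the function is a sum of multiples of
  \<open>?x i ^ t\<close> with \<open>?x i\<close> the fourth power of an integer prime to 5, so the
  \<open>s\<close>-th difference gives each summand the factor \<open>(?x i - 1) ^ s\<close>. The
  length of the power sum is chosen according to \<open>s\<close>.\<close>

lemma power_dvd_fwd_diff_unit_S:
  "5 ^ s dvd (fwd_diff ^^ s) (\<lambda>t. unit_S (r + 4 * t)) t"
proof -
  let ?I = "{i :: nat. i < 5 ^ Suc s \<and> i mod 5 \<noteq> 1}"
  let ?c = "\<lambda>i. (-1) ^ i * (4 * int i + 1) ^ r" and ?x = "\<lambda>i. (4 * int i + 1) ^ 4"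
  have "5 dvd ?x i - 1" if "i mod 5 \<noteq> 1" for i :: nat
  proof -
    from that have "int i mod 5 \<in> {0, 2, 3, 4}" by (simp, presburger)
    then obtain q a where qa: "int i = 5 * q + a" "a \<in> {0, 2, 3, 4 :: int}"
      using mult_div_mod_eq [of 5 "int i"] by metis
    have "[(4 * (5 * q + a) + 1) ^ 4 = (4 * (0 + a) + 1) ^ 4] (mod 5)"
      by (intro cong_pow cong_add cong_mult cong_refl) (simp add: cong_0_iff)
    also have "[(4 * (0 + a) + 1) ^ 4 = 1] (mod 5)"
      using qa(2) by (auto simp: cong_def)
    finally show ?thesis
      by (simp add: qa(1) cong_iff_dvd_diff)
  qed
  then have "5 ^ s dvd (\<Sum>i\<in>?I. ?c i * ?x i ^ t * (?x i - 1) ^ s)"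
    by (intro dvd_sum dvd_mult dvd_power_same) auto
  moreover have "[unit_S (r + 4 * t) = (\<Sum>i\<in>?I. ?c i * ?x i ^ t)] (mod 5 ^ s)" for t
    using unit_S_cong_unit_power_sum [of "r + 4 * t" s]
    by (simp add: power_add power_mult mult.assoc)
  then have "[(fwd_diff ^^ s) (\<lambda>t. unit_S (r + 4 * t)) t
      = (fwd_diff ^^ s) (\<lambda>t. \<Sum>i\<in>?I. ?c i * ?x i ^ t) t] (mod 5 ^ s)"
    by (rule fwd_diff_cong)
  ultimately show ?thesis
    unfolding fwd_diff_exponential_sum by (simp add: cong_dvd_iff)
qed

lemma newton_forward_mod:
  assumes "\<And>s. p \<le> s \<Longrightarrow> q dvd int (n choose s) * (fwd_diff ^^ s) f t"
  shows "[f (t + n) = (\<Sum>s<p. int (n choose s) * (fwd_diff ^^ s) f t)] (mod q)"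
proof -
  let ?g = "\<lambda>s. int (n choose s) * (fwd_diff ^^ s) f t"
  \<comment> \<open>The cut \<open>p\<close> may exceed \<open>n\<close>, so the range is first
    extended past both; the added binomial coefficients vanish.\<close>
  have "f (t + n) = sum ?g {..<p + Suc n}"
    unfolding newton_forward by (rule sum.mono_neutral_left) auto
  also have "\<dots> = sum ?g ({..<p + Suc n} - {..<p}) + sum ?g {..<p}"
    by (rule sum.subset_diff) auto
  finally have "f (t + n) - sum ?g {..<p} = sum ?g ({..<p + Suc n} - {..<p})"
    by (simp only: add_diff_cancel_right')
  also have "q dvd \<dots>"
    by (intro dvd_sum assms) simp
  finally show ?thesis
    by (simp only: cong_iff_dvd_diff)
qed

section \<open>Binomial coefficients and powers of 5\<close>

lemma int_binomial_Suc:
  "(int s + 1) * int (n choose Suc s) = (int n - int s) * int (n choose s)"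
proof (induction n arbitrary: s)
  case 0
  show ?case by (cases s) auto
next
  case (Suc n)
  show ?case
  proof (cases s)
    case (Suc r)
    then show ?thesis
      using Suc.IH [of r] Suc.IH [of s] by (simp add: algebra_simps)
  qed simp
qed

lemma int_binomial_small:
  shows "2 * int (n choose 2) = int n * (int n - 1)"
    and "6 * int (n choose 3) = int n * (int n - 1) * (int n - 2)"
    and "24 * int (n choose 4) = int n * (int n - 1) * (int n - 2) * (int n - 3)"
    and "120 * int (n choose 5) = int n * (int n - 1) * (int n - 2) * (int n - 3) * (int n - 4)"
proof -
  show 2: "2 * int (n choose 2) = int n * (int n - 1)"
    using int_binomial_Suc [of 1 n] by (simp add: numeral_eq_Suc)
  have "6 * int (n choose 3) = (int n - 2) * (2 * int (n choose 2))"
    using int_binomial_Suc [of 2 n] by (simp add: numeral_eq_Suc)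
  then show 3: "6 * int (n choose 3) = int n * (int n - 1) * (int n - 2)"
    by (simp only: 2 mult.commute)
  have "24 * int (n choose 4) = (int n - 3) * (6 * int (n choose 3))"
    using int_binomial_Suc [of 3 n] by (simp add: numeral_eq_Suc)
  then show 4: "24 * int (n choose 4) = int n * (int n - 1) * (int n - 2) * (int n - 3)"
    by (simp only: 3 mult.commute)
  have "120 * int (n choose 5) = (int n - 4) * (24 * int (n choose 4))"
    using int_binomial_Suc [of 4 n] by (simp add: numeral_eq_Suc)
  then show "120 * int (n choose 5) = int n * (int n - 1) * (int n - 2) * (int n - 3) * (int n - 4)"
    by (simp only: 4 mult.commute)
qed

text \<open>If \<open>v\<close> is the exponent of 5 in \<open>s\<close>, the identity
  \<open>s * (n choose s) = n * ((n - 1) choose (s - 1))\<close> shows that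
  \<open>n choose s\<close> loses at most \<open>v\<close> of the \<open>a\<close> factors 5 of
  \<open>n\<close>. The power \<open>5 ^ s\<close> makes up for this loss and leaves six factors
  over.\<close>

lemma power5_dvd_binomial_mult_power5:
  fixes n s a :: nat
  assumes "5 ^ a dvd n" and "6 \<le> s"
  shows "5 ^ (a + 6) dvd (n choose s) * 5 ^ s"
proof -
  define v where "v = multiplicity 5 s"
  obtain w where w: "s = 5 ^ v * w" "\<not> 5 dvd w"
    unfolding v_def by (rule multiplicity_decompose' [of s 5]) (use \<open>6 \<le> s\<close> in auto)
  \<comment> \<open>For \<open>v = 1\<close> the bound holds because a multiple of 5 that is at
    least 6 is at least 10; for larger \<open>v\<close> already \<open>5 ^ v\<close> is big
    enough.\<close>
  have "v + 6 \<le> s"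
  proof (cases "v \<le> 1")
    case True
    then consider "v = 0" | "v = 1" by linarith
    then show ?thesis
    proof cases
      case 2
      with w \<open>6 \<le> s\<close> have "w \<ge> 2" by (cases w) auto
      with w 2 show ?thesis by simp
    qed (use \<open>6 \<le> s\<close> in simp)
  next
    case False
    have "u + 8 \<le> 5 ^ (u + 2)" for u :: nat
      by (induction u) auto
    moreover obtain u where "v = u + 2"
      using False that [of "v - 2"] by simp
    ultimately have "v + 6 \<le> 5 ^ v"
      by (simp only: add.assoc) simp
    also have "\<dots> \<le> s"
      using w \<open>6 \<le> s\<close> by (cases w) auto
    finally show ?thesis .
  qed
  have "n * ((n - 1) choose (s - 1)) = s * (n choose s)"
    using \<open>6 \<le> s\<close> times_binomial_minus1_eq [of s n] by simp
  moreover have "s * c = w * (5 ^ v * c)" for c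
    by (subst w(1)) simp
  ultimately have "n * ((n - 1) choose (s - 1)) = w * (5 ^ v * (n choose s))"
    by simp
  with \<open>5 ^ a dvd n\<close> have "5 ^ a dvd w * (5 ^ v * (n choose s))"
    by (metis dvd_mult2)
  moreover have "coprime (5 ^ a) w"
    using w(2) prime_imp_coprime [of 5 w] by simp
  ultimately have "5 ^ a dvd 5 ^ v * (n choose s)"
    by (simp add: coprime_dvd_mult_right_iff)
  also have "\<dots> dvd 5 ^ (s - 6) * (n choose s)"
    using \<open>v + 6 \<le> s\<close> by (intro mult_dvd_mono le_imp_power_dvd) auto
  finally have "5 ^ a * 5 ^ 6 dvd 5 ^ (s - 6) * (n choose s) * 5 ^ 6"
    by (rule mult_dvd_mono) simp
  also have "\<dots> = (n choose s) * (5 ^ (s - 6) * 5 ^ 6)"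
    by simp
  finally show ?thesis
    using \<open>6 \<le> s\<close> by (simp only: flip: power_add) simp
qed

section \<open>The logarithm of the shift operator\<close>

text \<open>
  This is 120 times the expansion of the logarithm of the shift \<open>1 + fwd_diff\<close>, truncated after
  the fifth term.
\<close>

definition log_shift :: "(nat \<Rightarrow> int) \<Rightarrow> nat \<Rightarrow> int" where
  "log_shift f t = 120 * fwd_diff f t - 60 * (fwd_diff ^^ 2) f t + 40 * (fwd_diff ^^ 3) f t
    - 30 * (fwd_diff ^^ 4) f t + 24 * (fwd_diff ^^ 5) f t"

lemma log_shift_cong:
  assumes "\<And>t. [f t = g t] (mod M)"
  shows "[log_shift f t = log_shift g t] (mod M)"
  unfolding log_shift_def
  using fwd_diff_cong [OF assms, of 1]
  by (intro cong_add cong_diff cong_mult cong_refl fwd_diff_cong assms) simp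

text \<open>Both operators are polynomials in \<open>fwd_diff\<close>, so they commute.\<close>

lemma fwd_diff_funpow_log_shift:
  "(fwd_diff ^^ s) (log_shift f) = log_shift ((fwd_diff ^^ s) f)"
proof (induction s)
  case (Suc s)
  have "fwd_diff (log_shift g) = log_shift (fwd_diff g)" for g
    by (simp add: fun_eq_iff log_shift_def fwd_diff_def numeral_eq_Suc)
  with Suc show ?case by simp
qed simp

text \<open>In Newton's formula the terms of order 6 and above vanish modulo
  \<open>5 ^ (a + 6)\<close>. In the others, the part of \<open>120 * (n choose s)\<close> linear in
  \<open>n\<close> yields \<open>log_shift\<close>, and the rest is divisible by
  \<open>n ^ 2\<close>.\<close>

lemma shift_cong_log_shift:
  fixes f :: "nat \<Rightarrow> int" and a n t :: nat
  assumes f: "\<And>s t. 5 ^ s dvd (fwd_diff ^^ s) f t"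
    and "4 \<le> a" and n: "5 ^ a dvd n"
  shows "[120 * (f (t + n) - f t) = int n * log_shift f t] (mod 5 ^ (a + 7))"
proof -
  let ?d = "\<lambda>s. (fwd_diff ^^ s) f t" and ?N = "int n"
  have "5 ^ (a + 6) dvd int (n choose s) * ?d s" if "6 \<le> s" for s
  proof -
    have "int (5 ^ (a + 6)) dvd int ((n choose s) * 5 ^ s)"
      using power5_dvd_binomial_mult_power5 [OF n that] by (simp only: int_dvd_int_iff)
    also have "\<dots> dvd int (n choose s) * ?d s"
      using f [of s t] by simp
    finally show ?thesis by simp
  qed
  then have "5 ^ (a + 6) dvd f (t + n) - (\<Sum>s<6. int (n choose s) * ?d s)"
    using newton_forward_mod [of 6 "5 ^ (a + 6)" n f t] by (simp only: cong_iff_dvd_diff)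
  \<comment> \<open>The factor 5 of 120 gains one more power.\<close>
  then have "5 * 5 ^ (a + 6) dvd 5 * (24 * (f (t + n) - (\<Sum>s<6. int (n choose s) * ?d s)))"
    by (intro mult_dvd_mono dvd_mult) auto
  then have tail: "5 ^ (a + 7) dvd 120 * (f (t + n) - (\<Sum>s<6. int (n choose s) * ?d s))"
    by (simp add: power_add mult.commute)
  \<comment> \<open>This collects the parts of \<open>120 * (n choose s)\<close> of degree at least
    2 in \<open>n\<close>, divided by \<open>n ^ 2\<close>.\<close>
  let ?R = "60 * ?d 2 + 20 * (?N - 3) * ?d 3 + 5 * (?N ^ 2 - 6 * ?N + 11) * ?d 4
    + (?N ^ 3 - 10 * ?N ^ 2 + 35 * ?N - 50) * ?d 5"
  have "(\<Sum>s<6. int (n choose s) * ?d s) = f t + ?N * fwd_diff f t + int (n choose 2) * ?d 2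
      + int (n choose 3) * ?d 3 + int (n choose 4) * ?d 4 + int (n choose 5) * ?d 5"
    by (simp add: eval_nat_numeral)
  then have "120 * ((\<Sum>s<6. int (n choose s) * ?d s) - f t)
      = 120 * ?N * fwd_diff f t + 60 * (2 * int (n choose 2)) * ?d 2
        + 20 * (6 * int (n choose 3)) * ?d 3 + 5 * (24 * int (n choose 4)) * ?d 4
        + 120 * int (n choose 5) * ?d 5"
    by simp
  then have "120 * ((\<Sum>s<6. int (n choose s) * ?d s) - f t) - ?N * log_shift f t = ?N ^ 2 * ?R"
    unfolding int_binomial_small log_shift_def by (simp add: algebra_simps eval_nat_numeral)
  moreover have "5 ^ (a + 7) dvd ?N ^ 2 * ?R"
  \<comment> \<open>Here \<open>?R\<close> contributes \<open>5 ^ 3\<close>, and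
    \<open>2 * a + 3\<close> is at least \<open>a + 7\<close> because
    \<open>4 \<le> a\<close>.\<close>
  proof -
    have "125 dvd ?d s" if "3 \<le> s" for s
      using dvd_trans [OF le_imp_power_dvd [OF that, of 5] f [of s t]] by simp
    moreover have "125 dvd 60 * ?d 2"
      using mult_dvd_mono [of 5 60 25 "?d 2"] f [of 2 t] by simp
    ultimately have "5 ^ 3 dvd ?R"
      by (auto intro!: dvd_add intro: dvd_mult)
    moreover have "5 ^ a dvd ?N"
      using n by (metis int_dvd_int_iff of_nat_numeral of_nat_power)
    then have "5 ^ a * 5 ^ a dvd ?N ^ 2"
      unfolding power2_eq_square by (intro mult_dvd_mono)
    ultimately have "5 ^ a * 5 ^ a * 5 ^ 3 dvd ?N ^ 2 * ?R"
      by (intro mult_dvd_mono)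
    moreover have "(5 :: int) ^ (a + 7) dvd 5 ^ a * 5 ^ a * 5 ^ 3"
      using \<open>4 \<le> a\<close> by (simp only: flip: power_add) (rule le_imp_power_dvd, simp)
    ultimately show ?thesis
      by (rule dvd_trans [rotated])
  qed
  ultimately have "5 ^ (a + 7) dvd 120 * ((\<Sum>s<6. int (n choose s) * ?d s) - f t) - ?N * log_shift f t"
    by simp
  from dvd_add [OF tail this] show ?thesis
    by (simp add: cong_iff_dvd_diff algebra_simps)
qed

text \<open>Differences of \<open>log_shift f\<close> of order at least 5 vanish modulo
  \<open>5 ^ 7\<close>: the first four coefficients of \<open>log_shift\<close> supply a factor 5
  beside \<open>5 ^ 6\<close>, while the last one, 24, stands at a difference of order at least 10.
  The factor 24 clears the denominators of the binomial coefficients.\<close>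

lemma log_shift_cong_quartic:
  fixes f :: "nat \<Rightarrow> int"
  assumes f: "\<And>s t. 5 ^ s dvd (fwd_diff ^^ s) f t"
  defines "l \<equiv> \<lambda>j. (fwd_diff ^^ j) (log_shift f) 0"
  shows "[24 * log_shift f t = 24 * l 0 + 24 * l 1 * int t + 12 * l 2 * (int t * (int t - 1))
    + 4 * l 3 * (int t * (int t - 1) * (int t - 2))
    + l 4 * (int t * (int t - 1) * (int t - 2) * (int t - 3))] (mod 5 ^ 7)"
proof -
  have "5 ^ 7 dvd l j" if "5 \<le> j" for j
  proof -
    have d: "5 ^ p dvd (fwd_diff ^^ i) ((fwd_diff ^^ j) f) 0" if "p \<le> 5 + i" for p i
      using dvd_trans [OF le_imp_power_dvd [of p "i + j"] f [of "i + j" 0]] that \<open>5 \<le> j\<close>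
      by (simp add: funpow_add)
    have c: "5 ^ 7 dvd c * x" if "5 dvd c" "5 ^ 6 dvd x" for c x :: int
      using mult_dvd_mono [OF that] by simp
    have "5 ^ 7 dvd 120 * fwd_diff ((fwd_diff ^^ j) f) 0"
      using d [of 6 1] by (intro c) simp_all
    moreover have "5 ^ 7 dvd 60 * (fwd_diff ^^ 2) ((fwd_diff ^^ j) f) 0"
      by (intro c d) simp_all
    moreover have "5 ^ 7 dvd 40 * (fwd_diff ^^ 3) ((fwd_diff ^^ j) f) 0"
      by (intro c d) simp_all
    moreover have "5 ^ 7 dvd 30 * (fwd_diff ^^ 4) ((fwd_diff ^^ j) f) 0"
      by (intro c d) simp_all
    moreover have "5 ^ 7 dvd 24 * (fwd_diff ^^ 5) ((fwd_diff ^^ j) f) 0"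
      by (intro dvd_mult d) simp
    ultimately show ?thesis
      unfolding l_def fwd_diff_funpow_log_shift log_shift_def by (intro dvd_add dvd_diff)
  qed
  then have "[log_shift f (0 + t) = (\<Sum>j<5. int (t choose j) * l j)] (mod 5 ^ 7)"
    unfolding l_def by (intro newton_forward_mod dvd_mult)
  then have "[24 * log_shift f t = 24 * (\<Sum>j<5. int (t choose j) * l j)] (mod 5 ^ 7)"
    by (intro cong_mult cong_refl) simp
  also have "(\<Sum>j<5. int (t choose j) * l j) = l 0 + int t * l 1 + int (t choose 2) * l 2
      + int (t choose 3) * l 3 + int (t choose 4) * l 4"
    by (simp add: eval_nat_numeral)
  also have "24 * \<dots> = 24 * l 0 + 24 * l 1 * int t + 12 * l 2 * (int t * (int t - 1))
    + 4 * l 3 * (int t * (int t - 1) * (int t - 2))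
    + l 4 * (int t * (int t - 1) * (int t - 2) * (int t - 3))"
  proof -
    have "24 * (a0 + int t * a1 + b2 * a2 + b3 * a3 + b4 * a4) = 24 * a0 + 24 * a1 * int t
      + 12 * a2 * (2 * b2) + 4 * a3 * (6 * b3) + a4 * (24 * b4)" for a0 a1 a2 a3 a4 b2 b3 b4 :: int
      by (simp add: algebra_simps)
    then show ?thesis
      by (simp only: int_binomial_small)
  qed
  finally show ?thesis .
qed

section \<open>A verified table of \<open>S\<close> modulo \<open>5 ^ 7\<close>\<close>

text \<open>Row \<open>n\<close> lists the \<open>n\<close>-th binomial transforms of all tails of
  the table; Pascal's rule gives the next row, one entry shorter, without computing binomial
  coefficients. The modulus 78125 is \<open>5 ^ 7\<close>.\<close>

definition binomial_step :: "int list \<Rightarrow> int list" where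
  "binomial_step xs = map2 (\<lambda>a b. (b + 4 * a) mod 78125) xs (tl xs)"

fun check_residues :: "int list \<Rightarrow> int list \<Rightarrow> bool" where
  "check_residues row [] \<longleftrightarrow> True"
| "check_residues row (x # xs) \<longleftrightarrow>
    (hd row + x) mod 78125 = 2 \<and> check_residues (binomial_step row) xs"

text \<open>With \<open>E\<close> the shift of \<open>x\<close>, this is
  \<open>(E + c) ^ Suc n = E * (E + c) ^ n + c * (E + c) ^ n\<close>.\<close>

lemma binomial_sum_Suc:
  fixes x :: "nat \<Rightarrow> int"
  shows "(\<Sum>j\<le>Suc n. int (Suc n choose j) * c ^ (Suc n - j) * x (i + j))
    = (\<Sum>j\<le>n. int (n choose j) * c ^ (n - j) * x (Suc i + j))
      + c * (\<Sum>j\<le>n. int (n choose j) * c ^ (n - j) * x (i + j))"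
proof -
  let ?u = "\<lambda>j. int (n choose j) * c ^ (Suc n - j) * x (i + j)"
  have "(\<Sum>j\<le>Suc n. int (Suc n choose j) * c ^ (Suc n - j) * x (i + j))
    = c ^ Suc n * x i + (\<Sum>j\<le>n. int (Suc n choose Suc j) * c ^ (n - j) * x (Suc i + j))"
    by (subst sum.atMost_Suc_shift) simp
  also have "\<dots> = (\<Sum>j\<le>n. int (n choose j) * c ^ (n - j) * x (Suc i + j))
      + (?u 0 + (\<Sum>j\<le>n. ?u (Suc j)))"
    by (simp add: sum.distrib [symmetric] algebra_simps)
  also have "?u 0 + (\<Sum>j\<le>n. ?u (Suc j)) = (\<Sum>j\<le>Suc n. ?u j)"
    by (rule sum.atMost_Suc_shift [symmetric])
  also have "\<dots> = (\<Sum>j\<le>n. ?u j)"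
    by simp
  also have "\<dots> = c * (\<Sum>j\<le>n. int (n choose j) * c ^ (n - j) * x (i + j))"
    unfolding sum_distrib_left by (rule sum.cong) (auto simp: Suc_diff_le)
  finally show ?thesis .
qed

text \<open>The invariant is that \<open>row\<close> is the \<open>n\<close>-th row of transforms;
  its head then gives the equation at index \<open>n\<close>, and the induction advances
  \<open>n\<close> up to \<open>m\<close>.\<close>

lemma check_residues_sound:
  assumes "check_residues row (drop n xs)" and "length row = length xs - n"
    and "\<And>i. i < length row \<Longrightarrow>
      [row ! i = (\<Sum>j\<le>n. int (n choose j) * 4 ^ (n - j) * xs ! (i + j))] (mod 78125)"
    and "n \<le> m" and "m < length xs"
  shows "[(\<Sum>j\<le>m. int (m choose j) * 4 ^ (m - j) * xs ! j) + xs ! m = 2] (mod 78125)"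
  using assms
proof (induction "length xs - n" arbitrary: n row)
  case (Suc d)
  then have "drop n xs = xs ! n # drop (Suc n) xs" and "row \<noteq> []"
    by (auto simp: Cons_nth_drop_Suc)
  with Suc.prems(1) have hd: "[row ! 0 + xs ! n = 2] (mod 78125)"
    and rest: "check_residues (binomial_step row) (drop (Suc n) xs)"
    by (auto simp: cong_def hd_conv_nth)
  show ?case
  proof (cases "n = m")
    case True
    have "[(\<Sum>j\<le>n. int (n choose j) * 4 ^ (n - j) * xs ! (0 + j)) + xs ! n
        = row ! 0 + xs ! n] (mod 78125)"
      using Suc.prems(3) [of 0] \<open>row \<noteq> []\<close> by (intro cong_add cong_refl) (simp add: cong_sym_eq)
    from cong_trans [OF this hd] True show ?thesis by simp
  next
    case False
    show ?thesis
    proof (rule Suc.hyps(1) [OF _ rest])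
      fix i assume "i < length (binomial_step row)"
      then have i: "Suc i < length row"
        by (simp add: binomial_step_def)
      then have "binomial_step row ! i = (row ! Suc i + 4 * row ! i) mod 78125"
        by (simp add: binomial_step_def nth_tl)
      then have "[binomial_step row ! i = row ! Suc i + 4 * row ! i] (mod 78125)"
        by (simp add: cong_def)
      also have "[row ! Suc i + 4 * row ! i
          = (\<Sum>j\<le>n. int (n choose j) * 4 ^ (n - j) * xs ! (Suc i + j))
            + 4 * (\<Sum>j\<le>n. int (n choose j) * 4 ^ (n - j) * xs ! (i + j))] (mod 78125)"
        using i by (intro cong_add cong_mult cong_refl Suc.prems(3)) simp_all
      finally show "[binomial_step row ! i
          = (\<Sum>j\<le>Suc n. int (Suc n choose j) * 4 ^ (Suc n - j) * xs ! (i + j))] (mod 78125)"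
        unfolding binomial_sum_Suc .
    qed (use Suc False in \<open>auto simp: binomial_step_def\<close>)
  qed
qed simp

text \<open>Four differences of \<open>log_shift\<close>, which itself looks five steps ahead, use
  \<open>r + 4 * t\<close> for \<open>t\<close> up to 9. With \<open>r\<close> at most 3, the
  largest index is 39.\<close>

definition S_residues :: "int list" where
  "S_residues = [1, 78124, 78122, 11, 57, 77764, 75362, 24611, 16362, 17584, 59102, 77986,
    6542, 56329, 52017, 24386, 51972, 65249, 54982, 1686, 10902, 78094, 71997, 63386, 10332,
    19239, 41437, 69236, 42887, 44309, 1677, 60236, 32442, 52679, 53592, 24261, 55997, 12474,
    41807, 67936]"

lemma length_S_residues: "length S_residues = 40"
  by (simp add: S_residues_def)

lemma check_S_residues: "check_residues S_residues S_residues"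
  by code_simp

lemma S_residues_cong:
  assumes "n < 40"
  shows "[S_residues ! n = S n] (mod 78125)"
proof (rule cong_S_if_binomial_transform [where K = 40])
  show "[(\<Sum>j\<le>n. int (n choose j) * 4 ^ (n - j) * S_residues ! j) + S_residues ! n = 2] (mod 78125)"
    if "n < 40" for n
    using that check_S_residues length_S_residues
    by (intro check_residues_sound [where row = S_residues and n = 0]) simp_all
qed (use assms in simp_all)

text \<open>
  The table is continued by \<open>unit_S\<close> itself beyond its length, so that the congruence with
  \<open>unit_S\<close> holds everywhere.
\<close>

definition unit_S_table :: "nat \<Rightarrow> int" where
  "unit_S_table n = (if n < 40 then ((1 + 5 ^ n) * S_residues ! n) mod 78125 else unit_S n)"

lemma unit_S_table_cong: "[unit_S n = unit_S_table n] (mod 78125)"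
proof (cases "n < 40")
  case True
  have "[(1 + 5 ^ n) * S n = (1 + 5 ^ n) * S_residues ! n] (mod 78125)"
    using S_residues_cong [OF True] by (intro cong_mult cong_refl) (rule cong_sym)
  with True show ?thesis
    by (simp add: unit_S_table_def unit_S_def cong_def)
qed (simp add: unit_S_table_def)

section \<open>Computable quartics and their comparison with the claimed polynomials\<close>

lemma log_shift_eq:
  "log_shift f t = 24 * f (t + 5) - 150 * f (t + 4) + 400 * f (t + 3) - 600 * f (t + 2)
    + 600 * f (t + 1) - 274 * f t"
  by (simp add: log_shift_def fwd_diff_def eval_nat_numeral)

lemma fwd_diff_at_0:
  "(fwd_diff ^^ 0) h 0 = h 0"
  "(fwd_diff ^^ 1) h 0 = h 1 - h 0"
  "(fwd_diff ^^ 2) h 0 = h 2 - 2 * h 1 + h 0"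
  "(fwd_diff ^^ 3) h 0 = h 3 - 3 * h 2 + 3 * h 1 - h 0"
  "(fwd_diff ^^ 4) h 0 = h 4 - 4 * h 3 + 6 * h 2 - 4 * h 1 + h 0"
  by (simp_all add: fwd_diff_def eval_nat_numeral)

text \<open>Passing to the table turns the Newton coefficients into explicit integers without
  changing them modulo \<open>5 ^ 7\<close>.\<close>

lemma log_shift_unit_S_cong_quartic:
  fixes r t :: nat
  defines "l \<equiv> \<lambda>j. (fwd_diff ^^ j) (log_shift (\<lambda>t. unit_S_table (r + 4 * t))) 0"
  shows "[24 * log_shift (\<lambda>t. unit_S (r + 4 * t)) t
    = 24 * l 0 + 24 * l 1 * int t + 12 * l 2 * (int t * (int t - 1))
      + 4 * l 3 * (int t * (int t - 1) * (int t - 2))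
      + l 4 * (int t * (int t - 1) * (int t - 2) * (int t - 3))] (mod 5 ^ 7)"
proof -
  have "[(fwd_diff ^^ j) (log_shift (\<lambda>t. unit_S (r + 4 * t))) 0 = l j] (mod 5 ^ 7)" for j
    unfolding l_def using unit_S_table_cong by (intro fwd_diff_cong log_shift_cong) simp
  then show ?thesis
    by (intro cong_trans [OF log_shift_cong_quartic] power_dvd_fwd_diff_unit_S
        cong_add cong_mult cong_refl)
qed

lemma five_dvd_power5_diff: "5 dvd x ^ 5 - (x :: int)"
proof -
  have "x mod 5 \<in> {0, 1, 2, 3, 4}"
    by (simp, presburger)
  then have "(x mod 5) ^ 5 mod 5 = x mod 5"
    by auto
  then show ?thesis
    by (simp add: mod_eq_dvd_iff power_mod)
qed

text \<open>The two sides need only agree as functions on the integers: \<open>c\<close> absorbs a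
  term of degree 5 through Fermat's congruence, and \<open>A\<close> is the remaining quotient by
  \<open>5 ^ 7\<close>.\<close>

lemma cong_if_diff_eq:
  fixes x c A y z :: int
  assumes "y - z = 5 ^ 7 * A + 5 ^ 6 * c * (x ^ 5 - x)"
  shows "[y = z] (mod 5 ^ 7)"
proof -
  have "5 ^ 6 * 5 dvd 5 ^ 6 * (c * (x ^ 5 - x))"
    by (intro mult_dvd_mono dvd_mult five_dvd_power5_diff) simp
  then have "5 ^ 7 dvd 5 ^ 7 * A + 5 ^ 6 * c * (x ^ 5 - x)"
    by (intro dvd_add) (simp_all add: mult.assoc)
  then show ?thesis
    by (simp only: assms cong_iff_dvd_diff)
qed

text \<open>Since \<open>totient (5 ^ m) = 4 * 5 ^ (m - 1)\<close>, the index shift moves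
  \<open>t\<close> by \<open>k * 5 ^ (m - 1)\<close>. The constant 2880 is \<open>24 * 120\<close>,
  the product of the two cleared denominators.\<close>

lemma S_shift_cong:
  fixes b k m r t :: nat and P :: int
  assumes "m \<ge> 5" and "k > 0" and b: "b = r + 4 * t"
    and P: "[24 * log_shift (\<lambda>t. unit_S (r + 4 * t)) t = 2880 * P] (mod 5 ^ 7)"
  shows "[S (k * totient (5 ^ m) + b) - (1 + 5 ^ b) * S b = 5 ^ (m - 1) * int k * P] (mod 5 ^ (m + 5))"
proof -
  define a where "a = m - 1"
  then have a: "4 \<le> a" "m = Suc a"
    using \<open>m \<ge> 5\<close> by auto
  define n where "n = 5 ^ a * k"
  define f where "f = (\<lambda>t. unit_S (r + 4 * t))"
  define X where "X = f (t + n) - f t"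
  have "[24 * (120 * X) = 24 * (int n * log_shift f t)] (mod 5 ^ (a + 7))"
    unfolding X_def
    by (intro cong_mult cong_refl shift_cong_log_shift a)
      (simp_all only: f_def power_dvd_fwd_diff_unit_S n_def dvd_triv_left)
  also have "24 * (int n * log_shift f t) = int n * (24 * log_shift f t)"
    by simp
  also have "[\<dots> = int n * (2880 * P)] (mod 5 ^ (a + 7))"
  proof -
    have "5 ^ a * 5 ^ 7 dvd int n * (24 * log_shift f t - 2880 * P)"
      using P unfolding f_def n_def cong_iff_dvd_diff by (intro mult_dvd_mono) simp_all
    then show ?thesis
      by (simp only: cong_iff_dvd_diff power_add right_diff_distrib)
  qed
  finally have "5 ^ (a + 7) dvd 24 * (120 * X) - int n * (2880 * P)"
    by (simp only: cong_iff_dvd_diff)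
  \<comment> \<open>As \<open>2880 = 5 * 576\<close>, division costs exactly one power of 5, from
    \<open>a + 7\<close> to \<open>a + 6 = m + 5\<close>.\<close>
  also have "24 * (120 * X) - int n * (2880 * P) = 5 * (576 * (X - int n * P))"
    by simp
  also have "(5 :: int) ^ (a + 7) = 5 * 5 ^ (m + 5)"
    using a by (simp add: power_add)
  finally have "5 ^ (m + 5) dvd 576 * (X - int n * P)"
    by (simp only: dvd_mult_cancel_left) simp
  moreover have "coprime (5 :: int) 576"
    using prime_imp_coprime [of "5 :: int" 576] by simp
  then have "coprime (5 ^ (m + 5)) (576 :: int)"
    by simp
  ultimately have X: "5 ^ (m + 5) dvd X - int n * P"
    by (simp only: coprime_dvd_mult_right_iff)
  have "totient (5 ^ m) = 4 * 5 ^ a"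
    using totient_prime_power_Suc [of 5 a] a(2) by simp
  then have N: "k * totient (5 ^ m) + b = r + 4 * (t + n)"
    by (simp add: n_def b)
  \<comment> \<open>At the shifted index the factor \<open>1 + 5 ^ n\<close> of
    \<open>unit_S\<close> is thus 1 modulo \<open>5 ^ (m + 5)\<close>; at \<open>b\<close> it
    remains.\<close>
  have "m + 5 \<le> r + 4 * (t + n)"
  proof -
    have "a < 5 ^ a"
      by (rule power_gt_expt) simp
    also have "5 ^ a \<le> n"
      using \<open>k > 0\<close> by (simp add: n_def)
    finally show ?thesis
      using a by simp
  qed
  then have "5 ^ (m + 5) dvd 5 ^ (r + 4 * (t + n)) * S (r + 4 * (t + n))"
    by (intro dvd_mult2 le_imp_power_dvd)
  with X have "5 ^ (m + 5) dvd (X - int n * P) - 5 ^ (r + 4 * (t + n)) * S (r + 4 * (t + n))"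
    by (rule dvd_diff)
  also have "(X - int n * P) - 5 ^ (r + 4 * (t + n)) * S (r + 4 * (t + n))
      = S (r + 4 * (t + n)) - (1 + 5 ^ b) * S b - 5 ^ a * int k * P"
    by (simp add: X_def f_def unit_S_def b n_def algebra_simps)
  finally show ?thesis
    unfolding N cong_iff_dvd_diff using a(2) by simp
qed

section \<open>The four residue classes of \<open>b\<close> modulo 4\<close>

lemma log_shift_unit_S_0:
  assumes "b = 0 + 4 * t"
  shows "[24 * log_shift (\<lambda>t. unit_S (0 + 4 * t)) t
    = 2880 * (930 - 4875 * int b - 4625 * int b ^ 2 - 6250 * int b ^ 3
      - 3125 * int b ^ 4)] (mod 5 ^ 7)"
proof -
  have table:
    "(fwd_diff ^^ 0) (log_shift (\<lambda>t. unit_S_table (0 + 4 * t))) 0 = 6674100"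
    "(fwd_diff ^^ 1) (log_shift (\<lambda>t. unit_S_table (0 + 4 * t))) 0 = 8842500"
    "(fwd_diff ^^ 2) (log_shift (\<lambda>t. unit_S_table (0 + 4 * t))) 0 = -52260000"
    "(fwd_diff ^^ 3) (log_shift (\<lambda>t. unit_S_table (0 + 4 * t))) 0 = 144906250"
    "(fwd_diff ^^ 4) (log_shift (\<lambda>t. unit_S_table (0 + 4 * t))) 0 = -308375000"
    by (simp_all only: fwd_diff_at_0 log_shift_eq)
      (simp_all add: unit_S_table_def S_residues_def)
  \<comment> \<open>The claimed polynomial has degree 4, hence \<open>c = 0\<close>;
    \<open>A\<close> is the difference of the two sides divided by \<open>5 ^ 7\<close>.\<close>
  show ?thesis
    by (rule cong_trans [OF log_shift_unit_S_cong_quartic],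
        rule cong_if_diff_eq [where x = "int t" and c = "0" and
          A = "2016 + 49984 * int t
            - 70976 * int t ^ 2 + 45848 * int t ^ 3 + 25544 * int t ^ 4"])
      (simp only: table assms, simp add: algebra_simps eval_nat_numeral)
qed

lemma log_shift_unit_S_1:
  assumes "b = 1 + 4 * t"
  shows "[24 * log_shift (\<lambda>t. unit_S (1 + 4 * t)) t
    = 2880 * (4670 + 1450 * int b + 1250 * int b ^ 2 + 6250 * int b ^ 3
      + 3125 * int b ^ 4 + 6250 * int b ^ 5)] (mod 5 ^ 7)"
proof -
  have table:
    "(fwd_diff ^^ 0) (log_shift (\<lambda>t. unit_S_table (1 + 4 * t))) 0 = 8696900"
    "(fwd_diff ^^ 1) (log_shift (\<lambda>t. unit_S_table (1 + 4 * t))) 0 = -28985250"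
    "(fwd_diff ^^ 2) (log_shift (\<lambda>t. unit_S_table (1 + 4 * t))) 0 = 68518750"
    "(fwd_diff ^^ 3) (log_shift (\<lambda>t. unit_S_table (1 + 4 * t))) 0 = -148125000"
    "(fwd_diff ^^ 4) (log_shift (\<lambda>t. unit_S_table (1 + 4 * t))) 0 = 316187500"
    by (simp_all only: fwd_diff_at_0 log_shift_eq)
      (simp_all add: unit_S_table_def S_residues_def)
  \<comment> \<open>The value of \<open>c\<close> cancels the term in \<open>t ^ 5\<close>: it is
    \<open>- (2880 * 6250 * 4 ^ 5)\<close> divided by \<open>5 ^ 6\<close>.\<close>
  show ?thesis
    by (rule cong_trans [OF log_shift_unit_S_cong_quartic],
        rule cong_if_diff_eq [where x = "int t" and c = "-1179648" and
          A = "1824 - 304608 * int t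
            + 18076 * int t ^ 2 - 223560 * int t ^ 3 - 320356 * int t ^ 4"])
      (simp only: table assms, simp add: algebra_simps eval_nat_numeral)
qed

lemma log_shift_unit_S_2:
  assumes "b = 2 + 4 * t"
  shows "[24 * log_shift (\<lambda>t. unit_S (2 + 4 * t)) t
    = 2880 * (- 4235 + 3700 * int b - 3000 * int b ^ 2 + 6250 * int b ^ 3
      - 9375 * int b ^ 4 + 6250 * int b ^ 5)] (mod 5 ^ 7)"
proof -
  have table:
    "(fwd_diff ^^ 0) (log_shift (\<lambda>t. unit_S_table (2 + 4 * t))) 0 = -25466450"
    "(fwd_diff ^^ 1) (log_shift (\<lambda>t. unit_S_table (2 + 4 * t))) 0 = 34099750"
    "(fwd_diff ^^ 2) (log_shift (\<lambda>t. unit_S_table (2 + 4 * t))) 0 = -38082500"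
    "(fwd_diff ^^ 3) (log_shift (\<lambda>t. unit_S_table (2 + 4 * t))) 0 = 30562500"
    "(fwd_diff ^^ 4) (log_shift (\<lambda>t. unit_S_table (2 + 4 * t))) 0 = -7781250"
    by (simp_all only: fwd_diff_at_0 log_shift_eq)
      (simp_all add: unit_S_table_def S_residues_def)
  show ?thesis
    by (rule cong_trans [OF log_shift_unit_S_cong_quartic],
        rule cong_if_diff_eq [where x = "int t" and c = "-1179648" and
          A = "- 11184 - 255204 * int t
            - 194190 * int t ^ 2 - 425460 * int t ^ 3 - 501450 * int t ^ 4"])
      (simp only: table assms, simp add: algebra_simps eval_nat_numeral)
qed

lemma log_shift_unit_S_3:
  assumes "b = 3 + 4 * t"
  shows "[24 * log_shift (\<lambda>t. unit_S (3 + 4 * t)) t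
    = 2880 * (3725 - 1025 * int b - 2625 * int b ^ 2 + 6250 * int b ^ 3
      + 3125 * int b ^ 5)] (mod 5 ^ 7)"
proof -
  have table:
    "(fwd_diff ^^ 0) (log_shift (\<lambda>t. unit_S_table (3 + 4 * t))) 0 = -21382000"
    "(fwd_diff ^^ 1) (log_shift (\<lambda>t. unit_S_table (3 + 4 * t))) 0 = 39626750"
    "(fwd_diff ^^ 2) (log_shift (\<lambda>t. unit_S_table (3 + 4 * t))) 0 = -49205000"
    "(fwd_diff ^^ 3) (log_shift (\<lambda>t. unit_S_table (3 + 4 * t))) 0 = 25656250"
    "(fwd_diff ^^ 4) (log_shift (\<lambda>t. unit_S_table (3 + 4 * t))) 0 = 73593750"
    by (simp_all only: fwd_diff_at_0 log_shift_eq)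
      (simp_all add: unit_S_table_def S_residues_def)
  \<comment> \<open>The leading coefficient is now 3125 in place of 6250, which halves
    \<open>c\<close>.\<close>
  show ?thesis
    by (rule cong_trans [OF log_shift_unit_S_cong_quartic],
        rule cong_if_diff_eq [where x = "int t" and c = "-589824" and
          A = "- 39936 - 310292 * int t
            - 530430 * int t ^ 2 - 682636 * int t ^ 3 - 441426 * int t ^ 4"])
      (simp only: table assms, simp add: algebra_simps eval_nat_numeral)
qed

theorem theorem6p1:
  fixes b k m :: nat
  assumes "b > 0" and "k > 0" and "m \<ge> 5"
  shows "([b = 0] (mod 4) \<longrightarrow>
      [S (k * totient (5 ^ m) + b) - (1 + 5 ^ b) * S b =
        5 ^ (m - 1) * int k * (930 - 4875 * int b - 4625 * int b ^ 2 - 6250 * int b ^ 3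
          - 3125 * int b ^ 4)] (mod 5 ^ (m + 5))) \<and>
    ([b = 1] (mod 4) \<longrightarrow>
      [S (k * totient (5 ^ m) + b) - (1 + 5 ^ b) * S b =
        5 ^ (m - 1) * int k * (4670 + 1450 * int b + 1250 * int b ^ 2 + 6250 * int b ^ 3
          + 3125 * int b ^ 4 + 6250 * int b ^ 5)] (mod 5 ^ (m + 5))) \<and>
    ([b = 2] (mod 4) \<longrightarrow>
      [S (k * totient (5 ^ m) + b) - (1 + 5 ^ b) * S b =
        5 ^ (m - 1) * int k * (- 4235 + 3700 * int b - 3000 * int b ^ 2 + 6250 * int b ^ 3
          - 9375 * int b ^ 4 + 6250 * int b ^ 5)] (mod 5 ^ (m + 5))) \<and>
    ([b = 3] (mod 4) \<longrightarrow>
      [S (k * totient (5 ^ m) + b) - (1 + 5 ^ b) * S b =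
        5 ^ (m - 1) * int k * (3725 - 1025 * int b - 2625 * int b ^ 2 + 6250 * int b ^ 3
          + 3125 * int b ^ 5)] (mod 5 ^ (m + 5)))"
proof -
  define t where "t = b div 4"
  have b: "b = b mod 4 + 4 * t"
    by (simp add: t_def)
  have 0: "b = 0 + 4 * t" if "[b = 0] (mod 4)"
    using b that by (simp add: cong_def)
  have 1: "b = 1 + 4 * t" if "[b = 1] (mod 4)"
    using b that by (simp add: cong_def)
  have 2: "b = 2 + 4 * t" if "[b = 2] (mod 4)"
    using b that by (simp add: cong_def)
  have 3: "b = 3 + 4 * t" if "[b = 3] (mod 4)"
    using b that by (simp add: cong_def)
  note cong = S_shift_cong [OF assms(3,2)]
  show ?thesis
    by (intro conjI impI cong [OF 0 log_shift_unit_S_0 [OF 0]] cong [OF 1 log_shift_unit_S_1 [OF 1]]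
        cong [OF 2 log_shift_unit_S_2 [OF 2]] cong [OF 3 log_shift_unit_S_3 [OF 3]])
qed

end
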